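(* Let $\mathcal{X}=\mathbb{N}$, $\mathcal{Y}=\{0,1\}$, $\Phi=\{0,1\}^{\mathcal{X}}$ and $H_\bullet=\{(2,0),(1,1)\}$. For every integer $d\geq2$ there is a teacher class $\mathcal{T}^d$ over $\mathcal{X},\mathcal{Y},\Phi$ such that $\mathrm{DFFdim}(\mathcal{T}^d,H_\bullet)\leq d$ and, for every $k\geq1$, every $L\geq4(k+1)d$ and every (possibly randomized) DFF algorithm $\mathcal{A}$, \[M^L_k(\mathcal{A},\mathcal{T}^d,H_\bullet)\geq(k+1)d-k-2.\]
   Context: Setting. A teacher over $\mathcal{X},\mathcal{Y},\Phi$ ($\bot$ a null symbol) is a pair $T=(\ell,\psi)$ with $\ell:\mathcal{X}\to\mathcal{Y}$ and $\psi:\mathcal{X}\times\mathcal{X}\to\Phi\cup\{\bot\}$ such that whenever $\ell(x)\neq\ell(\hat x)$, $\phi:=\psi(x,\hat x)\in\Phi$, $\phi(x)=1$ and $\phi(\hat x)=0$. A teacher class is a set of teachers. A history is a non-empty $H\subseteq\mathcal{X}\times\mathcal{Y}$; a teacher $(\ell,\psi)$ is consistent with $H$ if $\ell(x)=y$ for all $(x,y)\in H$; $\mathcal{T}_H$ is the set of teachers in $\mathcal{T}$ consistent with $H$. DFF protocol. A DFF algorithm is given $H$ in advance. In each round $t$: an example $x_t$ arrives; the algorithm outputs $(\hat x_t,\hat y_t)\in H\cup\{(x_s,y_s):s<t\}$; if $\hat y_t=y_t$ (the provided label of $x_t$) it learns only that it was correct; otherwise (a mistake) it receives $y_t$ and a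 feature $\phi_t$. DFF dimension. A DFF tree is a rooted tree whose nodes are triples $\langle y,\phi,x\rangle$ with $y\in\mathcal{Y}\cup\{\bot\}$, $\phi\in\Phi\cup\{\bot\}$, $x\in\mathcal{X}\cup\{\bot\}$, such that the root has $y=\phi=\bot$, a node has $x=\bot$ iff it is a leaf, every edge is labeled by a pair $(\hat x,\hat y)\in\mathcal{X}\times\mathcal{Y}$, and every non-root node $\langle y,\phi,x\rangle$ with incoming edge $(\hat x,\hat y)$ has $\phi\neq\bot$ whenever $y\neq\hat y$. For a parent–child pair $\langle\cdot,\cdot,x\rangle\xrightarrow{(\hat x,\hat y)}\langle y,\phi,\cdot\rangle$ on a path, $(x,y)$ is called a labeled example in that path. A path from the root is consistent with a teacher $(\ell,\psi)$ if for every such parent–child pair on it, $\ell(x)=y$ and, if $y\neq\hat y$, $\psi(x,\hat x)=\phi$. Given $\mathcal{T}$ consistent with $H$, a DFF tree is shattered by $\mathcal{T}$ and $H$ if: (1) every non-root node $\langle y,\phi,x\rangle$ with incoming edge $(\hat x,\hat y)$ has $y\neq\hat y$; (2) the labels of the outgoing edges of each non-leaf node $v$ are exactly the pairs that belong to $H$ or are labeled examples in the path from the root to $v$; (3) every root-to-leaf path is consistent with some teacher in $\mathcal{T}_H$; (4) all root-to-leaf paths have the same number of edges, called the height. $\mathrm{DFFdim}(\mathcal{T},H)$ is the maximal height of a DFF tree shattered by $\mathcal{T}$ and $H$. Non-realizable mistake bound with adaptive adversary. An interaction over $L$ rounds produces $S=((x_t,y_t,\hat x_t,\hat y_t,\phi_t))_{t\in[L]}$,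 with $\phi_t=\bot$ when $\hat y_t=y_t$. An adversary, in each round $t$, chooses $(x_t,y_t,\psi_t)$ with $\psi_t:\mathcal{X}\times\mathcal{X}\to\Phi\cup\{\bot\}$ as a function of the past interaction $S_{t-1}$; then the algorithm chooses $(\hat x_t,\hat y_t)$ (possibly randomly) as a function of $S_{t-1}$ and $x_t$; then, if $\hat y_t\neq y_t$, $\phi_t=\psi_t(x_t,\hat x_t)$ is revealed together with $y_t$. $S$ is $k$-consistent with a teacher $(f,\psi)$ if there is $E\subseteq[L]$, $|E|\leq k$, such that for all $t\in[L]\setminus E$, $f(x_t)=y_t$ and, if $\hat y_t\neq y_t$, $\psi(x_t,\hat x_t)=\phi_t$. $M^L_k(\mathcal{A},\mathcal{T},H)$ is the supremum, over all adversaries whose interaction with $\mathcal{A}$ produces with probability $1$ a sequence that is $k$-consistent with some teacher in $\mathcal{T}_H$, of the expected number of mistakes of $\mathcal{A}$ over $L$ rounds. *)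

theory Defs
  imports "HOL-Probability.Probability" "HOL-Library.Z2"
begin

(* Features are functions X -> {0,1}; the null symbol \<bottom> is None. *)
type_synonym 'x feature = "'x \<Rightarrow> bit"
type_synonym ('x,'y) teacher = "('x \<Rightarrow> 'y) \<times> ('x \<Rightarrow> 'x \<Rightarrow> 'x feature option)"

definition is_teacher :: "('x,'y) teacher \<Rightarrow> bool" where
  "is_teacher T \<longleftrightarrow> (\<forall>x x'. fst T x \<noteq> fst T x' \<longrightarrow>
      (\<exists>\<phi>. snd T x x' = Some \<phi> \<and> \<phi> x = 1 \<and> \<phi> x' = 0))"

definition consistent_H :: "('x,'y) teacher \<Rightarrow> ('x \<times> 'y) set \<Rightarrow> bool" where
  "consistent_H T H \<longleftrightarrow> (\<forall>(x,y)\<in>H. fst T x = y)"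

definition teachers_H :: "('x,'y) teacher set \<Rightarrow> ('x \<times> 'y) set \<Rightarrow> ('x,'y) teacher set" where
  "teachers_H TC H = {T \<in> TC. consistent_H T H}"

(* A node <y,phi,x>; the children are given by a partial map from edge labels (x^,y^). *)
datatype ('x,'y) dfftree =
  DNode "'y option" "'x feature option" "'x option" "'x \<times> 'y \<Rightarrow> ('x,'y) dfftree option"

(* A path step records, for a parent-child pair  <_,_,x> --(x^,y^)--> <y,phi,_>,
   the tuple (x, y, x^, y^, phi). *)
type_synonym ('x,'y) pstep = "'x \<times> 'y option \<times> 'x \<times> 'y \<times> 'x feature option"

definition labeled_examples :: "('x,'y) pstep list \<Rightarrow> ('x \<times> 'y) set" where
  "labeled_examples P = {(x, y) | x y xh yh \<phi>. (x, Some y, xh, yh, \<phi>) \<in> set P}"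

definition path_consistent :: "('x,'y) pstep list \<Rightarrow> ('x,'y) teacher \<Rightarrow> bool" where
  "path_consistent P T \<longleftrightarrow> (\<forall>(x, y, xh, yh, \<phi>) \<in> set P.
      y = Some (fst T x) \<and> (y \<noteq> Some yh \<longrightarrow> snd T x xh = \<phi>))"

(* shattered_sub TC H h P t: the subtree t, reached along path P (the node's own y and phi are
   already recorded in P), satisfies conditions (1)-(3) and all its root-to-leaf paths have
   exactly h edges. *)
fun shattered_sub :: "('x,'y) teacher set \<Rightarrow> ('x \<times> 'y) set \<Rightarrow> nat \<Rightarrow> ('x,'y) pstep list
                       \<Rightarrow> ('x,'y) dfftree \<Rightarrow> bool" where
  "shattered_sub TC H 0 P (DNode y \<phi> xo ch) \<longleftrightarrow>
     xo = None \<and> (\<forall>e. ch e = None) \<and> (\<exists>T\<in>teachers_H TC H. path_consistent P T)"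
| "shattered_sub TC H (Suc h) P (DNode y \<phi> xo ch) \<longleftrightarrow>
     (\<exists>x0. xo = Some x0 \<and>
        dom ch = H \<union> labeled_examples P \<and>
        (\<forall>xh yh c. ch (xh, yh) = Some c \<longrightarrow>
           (case c of DNode y' \<phi>' xo' ch' \<Rightarrow>
              y' \<noteq> Some yh \<and> \<phi>' \<noteq> None \<and>
              shattered_sub TC H h (P @ [(x0, y', xh, yh, \<phi>')]) c)))"

definition shattered :: "('x,'y) teacher set \<Rightarrow> ('x \<times> 'y) set \<Rightarrow> nat \<Rightarrow> ('x,'y) dfftree \<Rightarrow> bool" where
  "shattered TC H h t \<longleftrightarrow>
     (case t of DNode y \<phi> xo ch \<Rightarrow> y = None \<and> \<phi> = None \<and> shattered_sub TC H h [] t)"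

definition DFFdim :: "('x,'y) teacher set \<Rightarrow> ('x \<times> 'y) set \<Rightarrow> enat" where
  "DFFdim TC H = Sup {enat h | h. \<exists>t. shattered TC H h t}"

(* A round record (x_t, y_t, x^_t, y^_t, phi_t). *)
type_synonym ('x,'y) round = "'x \<times> 'y \<times> 'x \<times> 'y \<times> 'x feature option"

(* Randomized algorithm (behavioural form): distribution of (x^_t,y^_t) given S_{t-1} and x_t. *)
type_synonym ('x,'y) dff_alg = "('x,'y) round list \<Rightarrow> 'x \<Rightarrow> ('x \<times> 'y) pmf"

type_synonym ('x,'y) adversary =
  "('x,'y) round list \<Rightarrow> 'x \<times> 'y \<times> ('x \<Rightarrow> 'x \<Rightarrow> 'x feature option)"

definition valid_dff_alg :: "('x \<times> 'y) set \<Rightarrow> ('x,'y) dff_alg \<Rightarrow> bool" where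
  "valid_dff_alg H A \<longleftrightarrow> (\<forall>S x. set_pmf (A S x) \<subseteq> H \<union> {(fst r, fst (snd r)) | r. r \<in> set S})"

fun dff_run :: "('x,'y) dff_alg \<Rightarrow> ('x,'y) adversary \<Rightarrow> nat \<Rightarrow> ('x,'y) round list pmf" where
  "dff_run A Adv 0 = return_pmf []"
| "dff_run A Adv (Suc n) =
     bind_pmf (dff_run A Adv n) (\<lambda>S.
       (case Adv S of (x, y, \<psi>) \<Rightarrow>
         map_pmf (\<lambda>(xh, yh). S @ [(x, y, xh, yh, if yh = y then None else \<psi> x xh)]) (A S x)))"

definition num_mistakes :: "('x,'y) round list \<Rightarrow> nat" where
  "num_mistakes S = card {t. t < length S \<and> fst (snd (snd (snd (S ! t)))) \<noteq> fst (snd (S ! t))}"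

definition k_consistent :: "nat \<Rightarrow> ('x,'y) round list \<Rightarrow> ('x,'y) teacher \<Rightarrow> bool" where
  "k_consistent k S T \<longleftrightarrow> (\<exists>E \<subseteq> {..<length S}. card E \<le> k \<and>
     (\<forall>t<length S. t \<notin> E \<longrightarrow>
        (case S ! t of (x, y, xh, yh, \<phi>) \<Rightarrow>
           fst T x = y \<and> (yh \<noteq> y \<longrightarrow> snd T x xh = \<phi>))))"

definition admissible_adv ::
  "nat \<Rightarrow> nat \<Rightarrow> ('x,'y) dff_alg \<Rightarrow> ('x,'y) teacher set \<Rightarrow> ('x \<times> 'y) set \<Rightarrow> ('x,'y) adversary \<Rightarrow> bool" where
  "admissible_adv L k A TC H Adv \<longleftrightarrow>
     (AE S in measure_pmf (dff_run A Adv L). \<exists>T\<in>teachers_H TC H. k_consistent k S T)"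

definition mistake_bound ::
  "nat \<Rightarrow> nat \<Rightarrow> ('x,'y) dff_alg \<Rightarrow> ('x,'y) teacher set \<Rightarrow> ('x \<times> 'y) set \<Rightarrow> ereal" where
  "mistake_bound L k A TC H =
     (SUP Adv \<in> {Adv. admissible_adv L k A TC H Adv}.
        ereal (measure_pmf.expectation (dff_run A Adv L) (\<lambda>S. real (num_mistakes S))))"

end

theory Submission
  imports Defs
begin

text \<open>
  A teacher carries a level function \<open>\<delta>\<close> and a secret level \<open>r \<in> {1..d}\<close>. Its feature for
  \<open>(x, x')\<close> says nothing beyond \<open>x\<close> itself if \<open>x\<close> lies exactly one level above \<open>x'\<close> and not on
  level \<open>r\<close>; otherwise it discloses the entire labelling.

  A learner that always answers with its latest mistake climbs one level per mistake and so hits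
  level \<open>r\<close>, and learns all labels, within \<open>d\<close> mistakes: the dimension is at most \<open>d\<close>.

  The non-realizable adversary presents fresh points with the label the algorithm is less likely to
  predict and returns only uninformative features, each mistake being placed one level above the
  example used for the prediction. After fewer than \<open>(k + 1) d\<close> mistakes one of the levels \<open>1..d\<close>
  contains at most \<open>k\<close> of them; declaring that level secret and its mistakes erroneous gives a
  \<open>k\<close>-consistent teacher. A potential argument shows that within \<open>4 (k + 1) d\<close> rounds the expected
  number of mistakes falls short of \<open>(k + 1) d - 1\<close> by at most one.
\<close>

section \<open>The teacher class and what its features disclose\<close>

definition point_feature :: "nat \<Rightarrow> nat feature" where
  "point_feature x = (\<lambda>z. if z = x then 1 else 0)"

definition full_feature :: "(nat \<Rightarrow> bit) \<Rightarrow> nat \<Rightarrow> nat feature" where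
  "full_feature f x = (\<lambda>z. if f z = f x then 1 else 0)"

text \<open>The clause \<open>x \<in> {1, 2}\<close> makes the answers at the two history points
  independent of \<open>\<delta>\<close> and \<open>r\<close>; the adversary relies on this when it
  repeats the point 1.\<close>

definition level_teacher :: "(nat \<Rightarrow> bit) \<Rightarrow> (nat \<Rightarrow> nat) \<Rightarrow> nat \<Rightarrow> (nat, bit) teacher" where
  "level_teacher f \<delta> r = (f, \<lambda>x x'. Some
     (if x \<in> {1, 2} \<or> \<delta> x = Suc (\<delta> x') \<and> \<delta> x \<noteq> r then point_feature x else full_feature f x))"

text \<open>\<open>\<delta> 1 = 0\<close> gives the climb through the levels a known start, the
  answer \<open>(1, 1)\<close>, below every admissible secret level.\<close>

definition level_class :: "nat \<Rightarrow> (nat, bit) teacher set" where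
  "level_class d = {level_teacher f \<delta> r | f \<delta> r. f 1 = 1 \<and> f 2 = 0 \<and> \<delta> 1 = 0 \<and> r \<in> {1..d}}"

abbreviation (input) hist :: "(nat \<times> bit) set" where
  "hist \<equiv> {(2, 0), (1, 1)}"

lemma level_classE:
  assumes "T \<in> level_class d"
  obtains f \<delta> r where "T = level_teacher f \<delta> r" "f 1 = 1" "f 2 = 0" "\<delta> 1 = 0" "r \<in> {1..d}"
  using assms unfolding level_class_def by blast

lemma fst_level_teacher [simp]: "fst (level_teacher f \<delta> r) = f"
  by (simp add: level_teacher_def)

lemma teachers_H_level_class: "teachers_H (level_class d) hist = level_class d"
  by (auto simp: teachers_H_def consistent_H_def elim: level_classE)

lemma is_teacher_level_class: "T \<in> level_class d \<Longrightarrow> is_teacher T"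
  by (auto elim!: level_classE simp: is_teacher_def level_teacher_def point_feature_def full_feature_def)

text \<open>The points 1 and 2 carry opposite labels, so the full feature is 1 at one of them, where
  the point feature of any other \<open>x\<close> is 0. A learner can thus tell which kind it
  received.\<close>

lemma full_feature_neq_point_feature:
  assumes "f 1 = 1" "f 2 = 0" "x \<notin> {1, 2}"
  shows "full_feature f x \<noteq> point_feature x"
proof
  assume eq: "full_feature f x = point_feature x"
  have "f x = 0 \<or> f x = 1" by (cases "f x") auto
  then show False
    using fun_cong[OF eq, of 1] fun_cong[OF eq, of 2] assms
    by (auto simp: full_feature_def point_feature_def split: if_splits)
qed

text \<open>The feature alone fixes a binary labelling up to complement; the common label at
  \<open>x\<close> settles which of the two it is.\<close>

lemma full_feature_inj:
  assumes "full_feature f x = full_feature g x" "f x = g x"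
  shows "f = g"
proof
  fix z
  have "(f z = f x) = (g z = g x)"
    using fun_cong[OF assms(1), of z] by (auto simp: full_feature_def split: if_splits)
  then show "f z = g z"
    using assms(2) by (cases "f z"; cases "g z"; cases "f x") auto
qed

section \<open>Upper bound on the dimension\<close>

lemma shattered_sub_SucE:
  assumes "shattered_sub TC H (Suc h) P t"
  obtains x0 where
    "\<And>xh yh. (xh, yh) \<in> H \<union> labeled_examples P \<Longrightarrow>
       \<exists>y \<phi> c. y \<noteq> Some yh \<and> shattered_sub TC H h (P @ [(x0, y, xh, yh, \<phi>)]) c"
proof -
  obtain y \<phi> xo ch where t: "t = DNode y \<phi> xo ch" by (cases t)
  obtain x0 where x0: "dom ch = H \<union> labeled_examples P"
    "\<And>xh yh c. ch (xh, yh) = Some c \<Longrightarrow> (case c of DNode y' \<phi>' xo' ch' \<Rightarrow>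
       y' \<noteq> Some yh \<and> \<phi>' \<noteq> None \<and> shattered_sub TC H h (P @ [(x0, y', xh, yh, \<phi>')]) c)"
    using assms unfolding t by auto
  have "\<exists>y \<phi> c. y \<noteq> Some yh \<and> shattered_sub TC H h (P @ [(x0, y, xh, yh, \<phi>)]) c"
    if e: "(xh, yh) \<in> H \<union> labeled_examples P" for xh yh
  proof -
    obtain c where c: "ch (xh, yh) = Some c" using e x0(1) by blast
    obtain y' \<phi>' xo' ch' where c': "c = DNode y' \<phi>' xo' ch'" by (cases c)
    show ?thesis using x0(2)[OF c] unfolding c' by auto
  qed
  then show ?thesis using that by blast
qed

lemma path_consistent_snoc:
  "path_consistent (P @ [(x, y, xh, yh, \<phi>)]) T \<longleftrightarrow>
     path_consistent P T \<and> y = Some (fst T x) \<and> (y \<noteq> Some yh \<longrightarrow> snd T x xh = \<phi>)"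
  by (auto simp: path_consistent_def)

text \<open>Shattering asks for a teacher only at the leaves. As \<open>H\<close> is non-empty,
  every inner node has a child, and the teacher of a leaf below is consistent with each prefix of
  its path.\<close>

lemma shattered_sub_consistent:
  assumes "shattered_sub TC H h P t" "H \<noteq> {}"
  shows "\<exists>T\<in>teachers_H TC H. path_consistent P T"
  using assms(1)
proof (induction h arbitrary: P t)
  case 0
  then show ?case by (cases t) auto
next
  case (Suc h)
  obtain xh yh where "(xh, yh) \<in> H" using assms(2) by fastforce
  with Suc.prems obtain x0 y \<phi> c
    where "shattered_sub TC H h (P @ [(x0, y, xh, yh, \<phi>)]) c"
    by (elim shattered_sub_SucE) blast
  from Suc.IH[OF this] show ?case by (auto simp: path_consistent_snoc)
qed

lemma ex_hist_label: "\<exists>xh. (xh, y) \<in> hist"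
  by (cases y) auto

text \<open>Both labels occur in the history, so the learner can answer with the forced label
  \<open>y0\<close>; a child contradicting it has no consistent teacher.\<close>

lemma no_shattered_children_at_known_label:
  assumes child: "\<And>xh yh. (xh, yh) \<in> hist \<Longrightarrow>
       \<exists>y \<phi> c. y \<noteq> Some yh \<and> shattered_sub TC hist h (P @ [(x0, y, xh, yh, \<phi>)]) c"
    and known: "\<And>T. T \<in> teachers_H TC hist \<Longrightarrow> path_consistent P T \<Longrightarrow> fst T x0 = y0"
  shows False
proof -
  obtain xh where "(xh, y0) \<in> hist" using ex_hist_label by blast
  with child obtain y \<phi> c where c: "y \<noteq> Some y0"
    "shattered_sub TC hist h (P @ [(x0, y, xh, y0, \<phi>)]) c" by blast
  from shattered_sub_consistent[OF c(2)] c(1) known show False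
    by (auto simp: path_consistent_snoc)
qed

lemma shattered_sub_known_labels:
  assumes "shattered_sub TC hist h P t"
    and "\<And>T. T \<in> teachers_H TC hist \<Longrightarrow> path_consistent P T \<Longrightarrow> fst T = f"
  shows "h = 0"
proof (cases h)
  case (Suc h')
  obtain x0 where x0:
    "\<And>xh yh. (xh, yh) \<in> hist \<union> labeled_examples P \<Longrightarrow>
       \<exists>y \<phi> c. y \<noteq> Some yh \<and> shattered_sub TC hist h' (P @ [(x0, y, xh, yh, \<phi>)]) c"
    using assms(1) unfolding Suc by (rule shattered_sub_SucE) blast
  have False
  proof (rule no_shattered_children_at_known_label)
    show "\<exists>y \<phi> c. y \<noteq> Some yh \<and> shattered_sub TC hist h' (P @ [(x0, y, xh, yh, \<phi>)]) c"
      if "(xh, yh) \<in> hist" for xh yh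
      using x0 that by blast
    show "fst T x0 = f x0" if "T \<in> teachers_H TC hist" "path_consistent P T" for T
      using assms(2)[OF that] by simp
  qed
  then show ?thesis ..
qed

text \<open>In the tree, let the learner always answer with its most recent mistake. As long as only point features
  come back, the i-th mistake sits on level i, so level r is reached within d mistakes.\<close>

lemma shattered_sub_level_bound:
  assumes "shattered_sub (level_class d) hist h P t"
    and "(a, ya) \<in> hist \<union> labeled_examples P"
    and "\<And>f \<delta> r. level_teacher f \<delta> r \<in> level_class d \<Longrightarrow> path_consistent P (level_teacher f \<delta> r)
           \<Longrightarrow> f 1 = 1 \<Longrightarrow> f 2 = 0 \<Longrightarrow> \<delta> 1 = 0 \<Longrightarrow> r \<in> {1..d} \<Longrightarrow> \<delta> a = i \<and> i < r"
  shows "h + i \<le> d"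
  using assms
proof (induction h arbitrary: P t a ya i)
  case 0
  obtain T where T: "T \<in> level_class d" "path_consistent P T"
    using shattered_sub_consistent[OF 0(1)] unfolding teachers_H_level_class by blast
  from T(1) show ?case
  proof (rule level_classE)
    fix f \<delta> r
    assume "T = level_teacher f \<delta> r" "f 1 = 1" "f 2 = 0" "\<delta> 1 = 0" "r \<in> {1..d}"
    with 0(3)[of f \<delta> r] T show ?thesis by auto
  qed
next
  case (Suc h)
  obtain x0 where x0: "\<And>xh yh. (xh, yh) \<in> hist \<union> labeled_examples P \<Longrightarrow>
       \<exists>y \<phi> c. y \<noteq> Some yh \<and> shattered_sub (level_class d) hist h (P @ [(x0, y, xh, yh, \<phi>)]) c"
    using Suc.prems(1) by (rule shattered_sub_SucE) blast
  \<comment> \<open>At a history point the point feature comes back whatever the levels are, so it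
    would not witness a climb. Such points are ruled out because their labels are known.\<close>
  have nh: "x0 \<notin> {1, 2}"
  proof
    assume "x0 \<in> {1, 2}"
    then have known: "fst T x0 = (if x0 = 1 then 1 else 0)" if "T \<in> level_class d" for T
      using that by (auto elim: level_classE)
    show False
    proof (rule no_shattered_children_at_known_label)
      show "\<exists>y \<phi> c. y \<noteq> Some yh \<and>
          shattered_sub (level_class d) hist h (P @ [(x0, y, xh, yh, \<phi>)]) c"
        if "(xh, yh) \<in> hist" for xh yh
        using x0 that by blast
      show "fst T x0 = (if x0 = 1 then 1 else 0)" if "T \<in> teachers_H (level_class d) hist" for T
        using known that unfolding teachers_H_level_class by blast
    qed
  qed
  from x0[OF Suc.prems(2)] obtain y \<phi> c where c: "y \<noteq> Some ya"
    "shattered_sub (level_class d) hist h (P @ [(x0, y, a, ya, \<phi>)]) c" by blast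
  obtain T0 where T0: "T0 \<in> level_class d" "path_consistent (P @ [(x0, y, a, ya, \<phi>)]) T0"
    using shattered_sub_consistent[OF c(2)] unfolding teachers_H_level_class by blast
  obtain f0 \<delta>0 r0 where lt0: "T0 = level_teacher f0 \<delta>0 r0" "f0 1 = 1" "f0 2 = 0" "\<delta>0 1 = 0" "r0 \<in> {1..d}"
    using T0(1) by (rule level_classE)
  have y: "y = Some (f0 x0)" using T0(2) lt0 by (simp add: path_consistent_snoc)
  have i: "i < d" using Suc.prems(3)[of f0 \<delta>0 r0] T0 lt0 by (auto simp: path_consistent_snoc)
  show ?case
  proof (cases "\<phi> = Some (point_feature x0)")
    case True
    have "h + Suc i \<le> d"
    proof (rule Suc.IH[OF c(2)])
      show "(x0, f0 x0) \<in> hist \<union> labeled_examples (P @ [(x0, y, a, ya, \<phi>)])"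
        by (auto simp: labeled_examples_def y)
      fix f \<delta> r
      assume A: "level_teacher f \<delta> r \<in> level_class d"
        "path_consistent (P @ [(x0, y, a, ya, \<phi>)]) (level_teacher f \<delta> r)"
        "f 1 = 1" "f 2 = 0" "\<delta> 1 = 0" "r \<in> {1..d}"
      have "\<delta> a = i \<and> i < r"
        using A Suc.prems(3)[of f \<delta> r] by (simp add: path_consistent_snoc)
      moreover have "snd (level_teacher f \<delta> r) x0 a = Some (point_feature x0)"
        using A(2) True c(1) by (simp add: path_consistent_snoc)
      \<comment> \<open>Off \<open>{1, 2}\<close> a point feature arises only if \<open>x0\<close>
        lies one level above \<open>a\<close> and not on level \<open>r\<close>; so
        \<open>Suc i \<noteq> r\<close>, which sharpens \<open>i < r\<close>.\<close>
      ultimately show "\<delta> x0 = Suc i \<and> Suc i < r"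
        using full_feature_neq_point_feature[OF A(3,4) nh] nh
        by (auto simp: level_teacher_def split: if_splits)
    qed
    then show ?thesis by simp
  next
    case False
    \<comment> \<open>Any other feature is a full one for every consistent teacher, so all of them
      share the labelling \<open>f0\<close> and this mistake is the last; \<open>i < d\<close>
      leaves room for it.\<close>
    have full: "Some (full_feature f x0) = \<phi>"
      if "path_consistent (P @ [(x0, y, a, ya, \<phi>)]) (level_teacher f \<delta> r)" for f \<delta> r
      using that False c(1) nh
      by (auto simp: path_consistent_snoc level_teacher_def split: if_splits)
    have "h = 0"
    proof (rule shattered_sub_known_labels[OF c(2)])
      fix T
      assume T: "T \<in> teachers_H (level_class d) hist" "path_consistent (P @ [(x0, y, a, ya, \<phi>)]) T"
      from T(1) have "T \<in> level_class d" by (simp add: teachers_H_def)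
      then obtain f \<delta> r where lt: "T = level_teacher f \<delta> r" by (rule level_classE)
      have "full_feature f x0 = full_feature f0 x0"
        using full[of f \<delta> r] full[of f0 \<delta>0 r0] T(2) T0(2) lt lt0(1)
        by (metis option.inject)
      moreover have "f x0 = f0 x0"
        using T(2) y lt by (simp add: path_consistent_snoc)
      ultimately show "fst T = f0" using full_feature_inj lt by simp
    qed
    then show ?thesis using i by simp
  qed
qed

lemma DFFdim_level_class: "DFFdim (level_class d) hist \<le> enat d"
  unfolding DFFdim_def
proof (rule Sup_least)
  fix e assume "e \<in> {enat h |h. \<exists>t. shattered (level_class d) hist h t}"
  then obtain h t where e: "e = enat h" and "shattered (level_class d) hist h t" by blast
  then have "shattered_sub (level_class d) hist h [] t"
    by (cases t) (auto simp: shattered_def)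
  then have "h + 0 \<le> d"
    by (rule shattered_sub_level_bound[of _ _ _ _ 1 1]) auto
  then show "e \<le> enat d" by (simp add: e)
qed

section \<open>Runs of the adversary\<close>

definition mistaken :: "(nat, bit) round \<Rightarrow> bool" where
  "mistaken = (\<lambda>(x, y, xh, yh, \<phi>). yh \<noteq> y)"

text \<open>Only these mistakes are charged to levels: at the points 1 and 2 the point feature is
  correct for every secret level.\<close>

definition fresh_mistake :: "(nat, bit) round \<Rightarrow> bool" where
  "fresh_mistake r \<longleftrightarrow> mistaken r \<and> fst r \<notin> {1, 2}"

lemma fresh_mistakeD: "fresh_mistake r \<Longrightarrow> mistaken r"
  by (simp add: fresh_mistake_def)

lemma num_mistakes_eq: "num_mistakes S = length (filter mistaken S)"
proof -
  have "mistaken r \<longleftrightarrow> fst (snd (snd (snd r))) \<noteq> fst (snd r)" for r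
    by (cases r) (auto simp: mistaken_def)
  then show ?thesis by (simp add: num_mistakes_def length_filter_conv_card)
qed

text \<open>For a fixed \<open>A\<close> the distribution of the next answer is determined by the
  past and the new point, so the adversary can use a label that is missed at least half of the
  time.\<close>

definition hard_label :: "(nat \<times> bit) pmf \<Rightarrow> bit" where
  "hard_label p = (if measure_pmf.prob p {e. snd e = 0} \<ge> 1 / 2 then 1 else 0)"

lemma prob_hard_label: "measure_pmf.prob p {e. snd e \<noteq> hard_label p} \<ge> 1 / 2"
proof (cases "measure_pmf.prob p {e. snd e = 0} \<ge> 1 / 2")
  case True
  have "{e. snd e \<noteq> (1::bit)} = {e :: nat \<times> bit. snd e = 0}" by auto
  then show ?thesis using True by (simp add: hard_label_def)
next
  case False
  have "{e. snd e \<noteq> (0::bit)} = UNIV - {e :: nat \<times> bit. snd e = 0}" by auto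
  then show ?thesis
    using False measure_pmf.prob_compl[of "{e. snd e = 0}" p] by (simp add: hard_label_def)
qed

definition level_adv :: "(nat, bit) dff_alg \<Rightarrow> nat \<Rightarrow> (nat, bit) adversary" where
  \<comment> \<open>Once \<open>N\<close> mistakes are reached, the point 1 is repeated: on it every teacher of the class
     returns the point feature, so that these rounds are never erroneous.\<close>
  "level_adv A N S =
     (if num_mistakes S < N then (3 + length S, hard_label (A S (3 + length S)), \<lambda>x x'. Some (point_feature x))
      else (1, 1, \<lambda>x x'. Some (point_feature x)))"

text \<open>The secret level does not occur here since it is chosen only after the run.\<close>

definition explains :: "(nat \<Rightarrow> bit) \<Rightarrow> (nat \<Rightarrow> nat) \<Rightarrow> (nat, bit) round \<Rightarrow> bool" where
  "explains f \<delta> = (\<lambda>(x, y, xh, yh, \<phi>). f x = y \<and>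
     (yh \<noteq> y \<longrightarrow> \<phi> = Some (point_feature x) \<and> (x \<notin> {1, 2} \<longrightarrow> \<delta> x = Suc (\<delta> xh))))"

lemma explains_fun_upd:
  assumes "explains f \<delta> (x, y, xh, yh, \<phi>)" "x \<noteq> z" "xh \<noteq> z"
  shows "explains (f(z := u)) (\<delta>(z := v)) (x, y, xh, yh, \<phi>)"
  using assms by (auto simp: explains_def)

text \<open>\<open>f\<close> and \<open>\<delta>\<close> are built along the run; the bound on the
  points makes the next one fresh, so extending both there keeps earlier rounds explained. The
  \<open>min\<close> drives the induction: before \<open>N\<close> mistakes are reached, the fresh
  ones also number fewer than \<open>N\<close>, leaving room for one more.\<close>

lemma level_adv_run:
  assumes valid: "valid_dff_alg hist A"
    and "S \<in> set_pmf (dff_run A (level_adv A N) n)"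
  shows "length S = n \<and> length (filter fresh_mistake S) \<le> min N (num_mistakes S) \<and>
    (\<forall>(x, y, xh, yh, \<phi>)\<in>set S. x < 3 + length S \<and> xh < 3 + length S) \<and>
    (\<exists>f \<delta>. f 1 = 1 \<and> f 2 = 0 \<and> \<delta> 1 = 0 \<and> (\<forall>r\<in>set S. explains f \<delta> r))"
  using assms(2)
proof (induction n arbitrary: S)
  case 0
  have "\<exists>f :: nat \<Rightarrow> bit. f 1 = 1 \<and> f 2 = 0" by (rule exI[of _ "\<lambda>x. if x = 1 then 1 else 0"]) simp
  then show ?case using 0 by auto
next
  case (Suc n)
  obtain S0 where S0: "S0 \<in> set_pmf (dff_run A (level_adv A N) n)"
    and "S \<in> set_pmf (case level_adv A N S0 of (x, y, \<psi>) \<Rightarrow>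
      map_pmf (\<lambda>(xh, yh). S0 @ [(x, y, xh, yh, if yh = y then None else \<psi> x xh)]) (A S0 x))"
    using Suc.prems by auto
  moreover obtain x y \<psi> where adv: "level_adv A N S0 = (x, y, \<psi>)" by (cases "level_adv A N S0")
  ultimately obtain xh yh where e: "(xh, yh) \<in> set_pmf (A S0 x)"
    and S: "S = S0 @ [(x, y, xh, yh, if yh = y then None else \<psi> x xh)]"
    by auto
  note IH = Suc.IH[OF S0]
  obtain f \<delta> where f: "f 1 = 1" "f 2 = 0" "\<delta> 1 = 0" "\<forall>r\<in>set S0. explains f \<delta> r"
    using IH by blast
  have bnd: "x' < 3 + length S0 \<and> xh' < 3 + length S0" if "(x', y', xh', yh', \<phi>') \<in> set S0" for x' y' xh' yh' \<phi>'
    using IH that by auto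
  have "(xh, yh) \<in> hist \<union> {(fst r, fst (snd r)) | r. r \<in> set S0}"
    using valid e unfolding valid_dff_alg_def by blast
  then have xh: "xh < 3 + length S0" using bnd by auto
  have \<psi>: "\<psi> x xh = Some (point_feature x)" using adv by (auto simp: level_adv_def split: if_splits)
  have len: "length S = Suc n" using IH S by simp
  have few: "length (filter fresh_mistake S0) \<le> min N (num_mistakes S0)" using IH by blast
  show ?case
  proof (cases "num_mistakes S0 < N")
    case True
    with adv have x: "x = 3 + length S0" by (simp add: level_adv_def)
    define f' where "f' = f(x := y)"
    \<comment> \<open>The answer \<open>xh\<close> is an older point and keeps its level, so the new
      point can be put right above it.\<close>
    define \<delta>' where "\<delta>' = \<delta>(x := Suc (\<delta> xh))"
    have "explains f' \<delta>' r" if "r \<in> set S0" for r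
    proof -
      obtain x' y' xh' yh' \<phi>' where r: "r = (x', y', xh', yh', \<phi>')" by (cases r)
      show ?thesis
        unfolding r f'_def \<delta>'_def
        by (rule explains_fun_upd) (use f that r bnd[of x' y' xh' yh' \<phi>'] x in auto)
    qed
    moreover have "explains f' \<delta>' (x, y, xh, yh, if yh = y then None else \<psi> x xh)"
      using \<psi> x xh by (auto simp: explains_def f'_def \<delta>'_def)
    moreover have "f' 1 = 1" "f' 2 = 0" "\<delta>' 1 = 0" using f x by (auto simp: f'_def \<delta>'_def)
    ultimately have "\<exists>f \<delta>. f 1 = 1 \<and> f 2 = 0 \<and> \<delta> 1 = 0 \<and> (\<forall>r\<in>set S. explains f \<delta> r)"
      unfolding S by (intro exI[of _ f'] exI[of _ \<delta>']) auto
    moreover have "length (filter fresh_mistake S) \<le> min N (num_mistakes S)"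
      using few True by (auto simp: S num_mistakes_eq dest: fresh_mistakeD)
    moreover have "\<forall>(x, y, xh, yh, \<phi>)\<in>set S. x < 3 + length S \<and> xh < 3 + length S"
      using bnd xh x by (fastforce simp: S)
    ultimately show ?thesis using len by blast
  next
    case False
    with adv have x: "x = 1" "y = 1" by (simp_all add: level_adv_def)
    \<comment> \<open>At the point 1 the level condition is waived, so \<open>f\<close> and
      \<open>\<delta>\<close> need no extension.\<close>
    have "\<forall>r\<in>set S. explains f \<delta> r"
      using f \<psi> x by (auto simp: S explains_def)
    moreover have "length (filter fresh_mistake S) \<le> min N (num_mistakes S)"
    proof -
      have "\<not> fresh_mistake (x, u)" for u using x by (simp add: fresh_mistake_def)
      then show ?thesis using few by (auto simp: S num_mistakes_eq)
    qed
    moreover have "\<forall>(x, y, xh, yh, \<phi>)\<in>set S. x < 3 + length S \<and> xh < 3 + length S"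
      using bnd xh x by (fastforce simp: S)
    ultimately show ?thesis using len f by blast
  qed
qed

section \<open>Choosing the secret level after the run\<close>

lemma sum_length_filter_le:
  assumes "finite R"
  shows "(\<Sum>r\<in>R. length (filter (\<lambda>s. Q s \<and> g s = r) S)) \<le> length (filter Q S)"
proof (induction S)
  case (Cons s S)
  have "(\<Sum>r\<in>R. length (filter (\<lambda>s. Q s \<and> g s = r) (s # S))) =
      (\<Sum>r\<in>R. (if r = g s then (if Q s then 1 else 0) else 0) + length (filter (\<lambda>s. Q s \<and> g s = r) S))"
    by (rule sum.cong) auto
  also have "\<dots> \<le> (if Q s then 1 else 0) + length (filter Q S)"
    using Cons assms by (simp add: sum.distrib)
  also have "\<dots> = length (filter Q (s # S))" by simp
  finally show ?case .
qed simp

lemma k_consistent_if_explained: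
  assumes f: "f 1 = 1" "f 2 = 0" "\<delta> 1 = 0" and ex: "\<forall>s\<in>set S. explains f \<delta> s"
    and few: "length (filter fresh_mistake S) < (k + 1) * d"
  shows "\<exists>T\<in>level_class d. k_consistent k S T"
proof -
  define lev where "lev r = filter (\<lambda>s. fresh_mistake s \<and> \<delta> (fst s) = r) S" for r
  have "\<exists>r\<in>{1..d}. length (lev r) \<le> k"
  proof (rule ccontr)
    assume "\<not> ?thesis"
    then have "(\<Sum>r\<in>{1..d}. k + 1) \<le> (\<Sum>r\<in>{1..d}. length (lev r))"
      by (intro sum_mono) (metis Suc_eq_plus1 not_less_eq_eq)
    with sum_length_filter_le[of "{1..d}" fresh_mistake "\<lambda>s. \<delta> (fst s)" S] few show False
      unfolding lev_def by (simp add: algebra_simps)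
  qed
  then obtain r where r: "r \<in> {1..d}" "length (lev r) \<le> k" by blast
  \<comment> \<open>At these rounds the teacher would give the full feature where the adversary gave
    the point feature; all other rounds agree with it.\<close>
  define E where "E = {t. t < length S \<and> fresh_mistake (S ! t) \<and> \<delta> (fst (S ! t)) = r}"
  have "card E \<le> k" using r(2) by (simp add: lev_def E_def length_filter_conv_card)
  moreover have "case S ! t of (x, y, xh, yh, \<phi>) \<Rightarrow>
      fst (level_teacher f \<delta> r) x = y \<and> (yh \<noteq> y \<longrightarrow> snd (level_teacher f \<delta> r) x xh = \<phi>)"
    if t: "t < length S" "t \<notin> E" for t
  proof -
    obtain x y xh yh \<phi> where st: "S ! t = (x, y, xh, yh, \<phi>)" by (cases "S ! t")
    have "explains f \<delta> (x, y, xh, yh, \<phi>)" using ex t(1) st nth_mem by metis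
    then show ?thesis using t st
      by (auto simp: explains_def level_teacher_def E_def fresh_mistake_def mistaken_def)
  qed
  ultimately have "k_consistent k S (level_teacher f \<delta> r)"
    unfolding k_consistent_def by (intro exI[of _ E]) (auto simp: E_def)
  moreover have "level_teacher f \<delta> r \<in> level_class d"
    using f r(1) unfolding level_class_def by blast
  ultimately show ?thesis by blast
qed

lemma level_adv_admissible:
  assumes "valid_dff_alg hist A" "N < (k + 1) * d"
  shows "admissible_adv L k A (level_class d) hist (level_adv A N)"
  unfolding admissible_adv_def AE_measure_pmf_iff teachers_H_level_class
proof
  fix S assume "S \<in> set_pmf (dff_run A (level_adv A N) L)"
  from level_adv_run[OF assms(1) this] obtain f \<delta> where
    "length (filter fresh_mistake S) \<le> N"
    "f 1 = 1" "f 2 = 0" "\<delta> 1 = 0" "\<forall>r\<in>set S. explains f \<delta> r" by auto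
  then show "\<exists>T\<in>level_class d. k_consistent k S T"
    using assms(2) by (intro k_consistent_if_explained[of f \<delta>]) auto
qed

section \<open>Expected number of mistakes\<close>

text \<open>The exponential form turns a mistake into a factor of at most 1/2, so the expectation
  contracts geometrically. From \<open>N\<close> mistakes on the value is 0 rather than 1, because
  the rounds at the point 1 may bring no mistake and a positive value would then not
  contract.\<close>

definition deficit_potential :: "nat \<Rightarrow> (nat, bit) round list \<Rightarrow> real" where
  "deficit_potential N S = (if num_mistakes S < N then 2 ^ (N - num_mistakes S) else 0)"

lemma deficit_potential_nonneg: "0 \<le> deficit_potential N S"
  by (simp add: deficit_potential_def)

lemma deficit_potential_snoc:
  "deficit_potential N (S @ [r]) \<le> deficit_potential N S * (1 - indicator {r. mistaken r} r / 2)"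
proof (cases "mistaken r \<and> num_mistakes S < N")
  case True
  then have "N - num_mistakes S = Suc (N - Suc (num_mistakes S))"
    by (simp add: Suc_diff_Suc)
  then have "(2::real) ^ (N - num_mistakes S) = 2 * 2 ^ (N - Suc (num_mistakes S))" by simp
  then show ?thesis using True
    by (auto simp: deficit_potential_def num_mistakes_eq)
qed (auto simp: deficit_potential_def num_mistakes_eq)

lemma deficit_le_potential: "real N - real (num_mistakes S) \<le> deficit_potential N S"
proof (cases "num_mistakes S < N")
  case True
  then have "real N - real (num_mistakes S) = real (N - num_mistakes S)" by simp
  also have "\<dots> \<le> 2 ^ (N - num_mistakes S)"
    using of_nat_less_two_power[of "N - num_mistakes S", where 'a=real] by simp
  finally show ?thesis using True by (simp add: deficit_potential_def)
qed (simp add: deficit_potential_def)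

text \<open>The hard label is missed with probability at least 1/2 and a mistake at least halves the
  potential, which gives the factor 1 - 1/2 * 1/2.\<close>

lemma level_adv_step_potential:
  assumes adv: "level_adv A N S = (x, y, \<psi>)"
  shows "(\<integral>\<^sup>+ (xh, yh). ennreal (deficit_potential N (S @ [(x, y, xh, yh, g xh yh)])) \<partial>A S x)
    \<le> ennreal (3 / 4) * ennreal (deficit_potential N S)"
proof (cases "num_mistakes S < N")
  case True
  let ?V = "deficit_potential N S"
  let ?M = "{e :: nat \<times> bit. snd e \<noteq> y}"
  from True adv have y: "y = hard_label (A S x)" by (auto simp: level_adv_def)
  have "(\<integral>\<^sup>+ (xh, yh). ennreal (deficit_potential N (S @ [(x, y, xh, yh, g xh yh)])) \<partial>A S x)
      \<le> (\<integral>\<^sup>+ e. ennreal (?V * (1 - indicator ?M e / 2)) \<partial>A S x)"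
  proof (rule nn_integral_mono)
    fix e :: "nat \<times> bit"
    obtain xh yh where e: "e = (xh, yh)" by (cases e)
    show "(case e of (xh, yh) \<Rightarrow> ennreal (deficit_potential N (S @ [(x, y, xh, yh, g xh yh)])))
        \<le> ennreal (?V * (1 - indicator ?M e / 2))"
      using deficit_potential_snoc[of N S "(x, y, xh, yh, g xh yh)"]
      by (auto simp: e mistaken_def indicator_def intro!: ennreal_leI)
  qed
  \<comment> \<open>The integrand contains a subtraction, so linearity is applied to the real-valued
    integral.\<close>
  also have "\<dots> = ennreal (measure_pmf.expectation (A S x) (\<lambda>e. ?V * (1 - indicator ?M e / 2)))"
  proof (rule nn_integral_eq_integral)
    have "norm (?V * (1 - indicator ?M e / 2)) \<le> ?V" for e
      using deficit_potential_nonneg[of N S] by (cases "e \<in> ?M") auto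
    then show "integrable (measure_pmf (A S x)) (\<lambda>e. ?V * (1 - indicator ?M e / 2))"
      by (intro measure_pmf.integrable_const_bound[of _ ?V] AE_I2) auto
  qed (auto simp: deficit_potential_nonneg indicator_def)
  also have "measure_pmf.expectation (A S x) (\<lambda>e. ?V * (1 - indicator ?M e / 2)) =
      ?V * (1 - measure_pmf.prob (A S x) ?M / 2)"
  proof -
    have "integrable (measure_pmf (A S x)) (indicat_real ?M)"
      by (rule measure_pmf.integrable_const_bound[of _ 1]) auto
    then show ?thesis by (simp add: Bochner_Integration.integral_diff)
  qed
  also have "\<dots> \<le> ?V * (3 / 4)"
    using prob_hard_label[of "A S x"] by (intro mult_left_mono) (auto simp: y deficit_potential_nonneg)
  finally have "(\<integral>\<^sup>+ (xh, yh). ennreal (deficit_potential N (S @ [(x, y, xh, yh, g xh yh)])) \<partial>A S x)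
      \<le> ennreal (?V * (3 / 4))" by (simp add: ennreal_leI)
  also have "\<dots> = ennreal (3 / 4) * ennreal ?V"
    by (subst mult.commute, rule ennreal_mult) (simp_all add: deficit_potential_nonneg)
  finally show ?thesis .
next
  case False
  then have "deficit_potential N (S @ [r]) = 0" for r
    by (simp add: deficit_potential_def num_mistakes_eq)
  then show ?thesis by (simp add: case_prod_unfold)
qed

lemma level_adv_run_potential:
  "(\<integral>\<^sup>+ S. ennreal (deficit_potential N S) \<partial>dff_run A (level_adv A N) n) \<le> ennreal ((3 / 4) ^ n * 2 ^ N)"
proof (induction n)
  case 0
  show ?case by (simp add: deficit_potential_def num_mistakes_eq)
next
  case (Suc n)
  have "(\<integral>\<^sup>+ S. ennreal (deficit_potential N S) \<partial>dff_run A (level_adv A N) (Suc n)) \<le>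
      (\<integral>\<^sup>+ S. ennreal (3 / 4) * ennreal (deficit_potential N S) \<partial>dff_run A (level_adv A N) n)"
    unfolding dff_run.simps nn_integral_bind_pmf
  proof (rule nn_integral_mono)
    fix S
    obtain x y \<psi> where adv: "level_adv A N S = (x, y, \<psi>)" by (cases "level_adv A N S")
    show "(\<integral>\<^sup>+ S. ennreal (deficit_potential N S) \<partial>(case level_adv A N S of (x, y, \<psi>) \<Rightarrow>
        map_pmf (\<lambda>(xh, yh). S @ [(x, y, xh, yh, if yh = y then None else \<psi> x xh)]) (A S x)))
        \<le> ennreal (3 / 4) * ennreal (deficit_potential N S)"
      using level_adv_step_potential[OF adv, of "\<lambda>xh yh. if yh = y then None else \<psi> x xh"]
      unfolding adv prod.case by (simp add: case_prod_unfold)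
  qed
  also have "\<dots> = ennreal (3 / 4) * (\<integral>\<^sup>+ S. ennreal (deficit_potential N S) \<partial>dff_run A (level_adv A N) n)"
    by (rule nn_integral_cmult) simp
  also have "\<dots> \<le> ennreal (3 / 4) * ennreal ((3 / 4) ^ n * 2 ^ N)"
    by (intro mult_left_mono Suc.IH) simp
  also have "\<dots> = ennreal ((3 / 4) ^ Suc n * 2 ^ N)"
    by (simp add: ennreal_mult'[symmetric] mult.assoc)
  finally show ?case .
qed

lemma level_adv_expected_mistakes:
  assumes valid: "valid_dff_alg hist A" and L: "L \<ge> 4 * N"
  shows "real N - 1 \<le> measure_pmf.expectation (dff_run A (level_adv A N) L) (\<lambda>S. real (num_mistakes S))"
proof -
  let ?p = "dff_run A (level_adv A N) L"
  have int_V: "integrable (measure_pmf ?p) (deficit_potential N)"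
    by (rule measure_pmf.integrable_const_bound[of _ "2 ^ N"])
       (auto simp: deficit_potential_def intro!: power_increasing)
  have "num_mistakes S \<le> L" if "S \<in> set_pmf ?p" for S
    using level_adv_run[OF valid that] by (auto simp: num_mistakes_eq)
  then have int_m: "integrable (measure_pmf ?p) (\<lambda>S. real (num_mistakes S))"
    by (intro measure_pmf.integrable_const_bound[of _ "real L"]) (auto simp: AE_measure_pmf_iff)
  have "ennreal (measure_pmf.expectation ?p (deficit_potential N)) =
      (\<integral>\<^sup>+ S. ennreal (deficit_potential N S) \<partial>?p)"
    by (rule nn_integral_eq_integral[symmetric, OF int_V]) (simp add: deficit_potential_nonneg)
  also have "\<dots> \<le> ennreal ((3 / 4) ^ L * 2 ^ N)"
    by (rule level_adv_run_potential)
  finally have "measure_pmf.expectation ?p (deficit_potential N) \<le> (3 / 4) ^ L * 2 ^ N"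
    by (simp add: ennreal_le_iff)
  also have "\<dots> \<le> (3 / 4) ^ (4 * N) * 2 ^ N"
    using L by (intro mult_right_mono power_decreasing) auto
  \<comment> \<open>Four rounds per targeted mistake suffice, since \<open>(3 / 4) ^ 4 * 2\<close>
    is 81/128; this is the source of the 4 in the bound on \<open>L\<close>.\<close>
  also have "\<dots> = ((3 / 4) ^ 4 * 2) ^ N"
    by (simp only: power_mult power_mult_distrib)
  also have "\<dots> \<le> (1 :: real)"
    by (rule power_le_one) (simp_all add: power4_eq_xxxx)
  finally have V: "measure_pmf.expectation ?p (deficit_potential N) \<le> 1" .
  have "real N - measure_pmf.expectation ?p (deficit_potential N) =
      measure_pmf.expectation ?p (\<lambda>S. real N - deficit_potential N S)"
    using int_V by simp
  also have "\<dots> \<le> measure_pmf.expectation ?p (\<lambda>S. real (num_mistakes S))"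
  proof (rule integral_mono)
    show "real N - deficit_potential N S \<le> real (num_mistakes S)" for S
      using deficit_le_potential[of N S] by linarith
  qed (use int_V int_m in auto)
  finally show ?thesis using V by linarith
qed

lemma level_class_nonempty:
  assumes "d \<ge> 1"
  shows "level_class d \<noteq> {}"
proof -
  define f :: "nat \<Rightarrow> bit" where "f x = (if x = 1 then 1 else 0)" for x
  have "f 1 = 1 \<and> f 2 = 0 \<and> (1 :: nat) \<in> {1..d}" using assms by (simp add: f_def)
  then have "level_teacher f (\<lambda>_. 0) 1 \<in> level_class d"
    unfolding level_class_def by blast
  then show ?thesis by blast
qed

theorem mainTheorem14:
  fixes d :: nat
  assumes "d \<ge> 2"
  shows "\<exists>TC :: (nat, bit) teacher set.
           (\<forall>T\<in>TC. is_teacher T) \<and>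
           teachers_H TC {(2, 0), (1, 1)} \<noteq> {} \<and>
           DFFdim TC {(2, 0), (1, 1)} \<le> enat d \<and>
           (\<forall>k L (A :: (nat, bit) dff_alg). k \<ge> 1 \<longrightarrow> L \<ge> 4 * (k + 1) * d \<longrightarrow>
              valid_dff_alg {(2, 0), (1, 1)} A \<longrightarrow>
              mistake_bound L k A TC {(2, 0), (1, 1)} \<ge> ereal (real ((k + 1) * d) - real k - 2))"
proof (intro exI[of _ "level_class d"] conjI allI impI ballI)
  show "is_teacher T" if "T \<in> level_class d" for T
    using that by (rule is_teacher_level_class)
  show "teachers_H (level_class d) hist \<noteq> {}"
    unfolding teachers_H_level_class using assms by (intro level_class_nonempty) simp
  show "DFFdim (level_class d) hist \<le> enat d"
    by (rule DFFdim_level_class)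
  fix k L :: nat and A :: "(nat, bit) dff_alg"
  assume L: "L \<ge> 4 * (k + 1) * d" and valid: "valid_dff_alg hist A"
  \<comment> \<open>The largest target that the pigeonhole argument over the \<open>d\<close> levels
    admits.\<close>
  define N where "N = (k + 1) * d - 1"
  have pos: "(k + 1) * d \<ge> 1" using assms by (simp add: Suc_le_eq)
  have N: "real N = real ((k + 1) * d) - 1" unfolding N_def using pos by (simp add: of_nat_diff)
  have "admissible_adv L k A (level_class d) hist (level_adv A N)"
    using valid by (rule level_adv_admissible) (use pos in \<open>simp add: N_def\<close>)
  then have "ereal (measure_pmf.expectation (dff_run A (level_adv A N) L) (\<lambda>S. real (num_mistakes S)))
      \<le> mistake_bound L k A (level_class d) hist"
    unfolding mistake_bound_def by (intro SUP_upper) simp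
  moreover have "4 * N \<le> 4 * ((k + 1) * d)" unfolding N_def by (intro mult_left_mono diff_le_self) simp
  then have "4 * N \<le> L" using L by (simp only: mult.assoc)
  \<comment> \<open>The expectation is at least \<open>N - 1\<close>, that is
    \<open>(k + 1) * d - 2\<close>; subtracting \<open>k\<close> as well only weakens this.\<close>
  then have "real ((k + 1) * d) - real k - 2 \<le>
      measure_pmf.expectation (dff_run A (level_adv A N) L) (\<lambda>S. real (num_mistakes S))"
    using level_adv_expected_mistakes[OF valid, of N L] N by linarith
  ultimately show "ereal (real ((k + 1) * d) - real k - 2) \<le> mistake_bound L k A (level_class d) hist"
    by (meson ereal_less_eq(3) order_trans)
qed

end
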